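(* Let $K\subset\hat{\mathbb{C}}$ be a compactum and $x,y\in K$. Then $(x,y)\in R_K$ if and only if there is an open region $W\subset\hat{\mathbb{C}}$ whose boundary consists of $n\ge2$ pairwise disjoint simple closed curves $\Gamma_1,\ldots,\Gamma_n$ such that $\overline{W}\cap K$ has infinitely many components $P_k$ each intersecting both $\Gamma_1$ and $\Gamma_2$, whose limit $P_\infty=\lim_kP_k$ under the Hausdorff distance satisfies $x\in\Gamma_1\cap P_\infty$ and $y\in\Gamma_2\cap P_\infty$.
   Context: For disjoint simple closed curves $J_1,J_2\subset\hat{\mathbb{C}}$, let $U(J_1,J_2)$ be the component of $\hat{\mathbb{C}}\setminus(J_1\cup J_2)$ whose boundary is $J_1\cup J_2$ (an open annulus). The Schönflies relation $R_K$ on a compactum $K\subset\hat{\mathbb{C}}$: two points $x\ne y$ of $K$ satisfy $(x,y)\in R_K$ if there exist disjoint simple closed curves $J_1\ni x$ and $J_2\ni y$ such that $\overline{U(J_1,J_2)}\cap K$ contains an infinite sequence of distinct components $P_n$, each intersecting both $J_1$ and $J_2$, whose Hausdorff limit $\lim_n P_n$ contains $\{x,y\}$. *)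

theory Defs
  imports "HOL-Analysis.Analysis"
begin

text \<open>The Riemann sphere, realised as the unit sphere in R^3 (stereographic
  projection), with the chordal (Euclidean) metric.\<close>
definition riemann_sphere :: "(real^3) set" where
  "riemann_sphere = sphere 0 1"

definition simple_closed_curve :: "(real^3) set \<Rightarrow> bool" where
  "simple_closed_curve J \<longleftrightarrow> J \<subseteq> riemann_sphere \<and>
     (\<exists>g. simple_path g \<and> pathfinish g = pathstart g \<and> path_image g = J)"

text \<open>Hausdorff distance between (nonempty bounded) sets.\<close>
definition hausdorff_dist :: "'a::metric_space set \<Rightarrow> 'a set \<Rightarrow> real" where
  "hausdorff_dist A B = max (SUP a\<in>A. infdist a B) (SUP b\<in>B. infdist b A)"

definition hausdorff_limit :: "(nat \<Rightarrow> 'a::metric_space set) \<Rightarrow> 'a set \<Rightarrow> bool" where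
  "hausdorff_limit P L \<longleftrightarrow> compact L \<and> L \<noteq> {} \<and>
     (\<lambda>n. hausdorff_dist (P n) L) \<longlonglongrightarrow> 0"

definition annulus_between :: "(real^3) set \<Rightarrow> (real^3) set \<Rightarrow> (real^3) set \<Rightarrow> bool" where
  "annulus_between J1 J2 U \<longleftrightarrow>
     U \<in> components (riemann_sphere - (J1 \<union> J2)) \<and>
     (top_of_set riemann_sphere) frontier_of U = J1 \<union> J2"

definition schoenflies_rel :: "(real^3) set \<Rightarrow> ((real^3) \<times> (real^3)) set" where
  "schoenflies_rel K = {(x, y). x \<in> K \<and> y \<in> K \<and> x \<noteq> y \<and>
     (\<exists>J1 J2 U P L. simple_closed_curve J1 \<and> simple_closed_curve J2 \<and>
        J1 \<inter> J2 = {} \<and> x \<in> J1 \<and> y \<in> J2 \<and> annulus_between J1 J2 U \<and>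
        inj P \<and>
        (\<forall>n. P n \<in> components (closure U \<inter> K) \<and> P n \<inter> J1 \<noteq> {} \<and> P n \<inter> J2 \<noteq> {}) \<and>
        hausdorff_limit P L \<and> x \<in> L \<and> y \<in> L)}"

end

theory Submission
  imports Defs
begin

text \<open>For the nontrivial direction, take the component U of the complement of the first two curves
  that contains W. Contracting the curves of index 1, 2 and i (at least 3), together with their
  complementary domains, to points shows that three disjoint continua in the closure of W, each
  meeting all three curves, would give a planar embedding of the complete bipartite graph on 3 + 3
  vertices. So all but finitely many of the P k avoid the curves of index at least 3. Such a P k has
  a relatively clopen neighbourhood in the trace of K on the closure of W that avoids these curves
  too; since U and W agree near the first two curves, it is clopen in the trace of K on the closure
  of U, and so P k is a component there.

  Nonplanarity is derived from Janiszewski's theorem and its dual: the first two continua joined by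
  a crosscut in each of the three domains form a theta-shaped set whose complement would have a
  component, containing the third continuum, that borders all three crosscuts.\<close>

section \<open>Connected sets and the outside of a set\<close>

lemma connected_Un_closure_meets:
  assumes "connected S" "connected T" "closure S \<inter> T \<noteq> {}"
  shows "connected (S \<union> T)"
proof -
  obtain z where z: "z \<in> closure S" "z \<in> T" using assms by blast
  have "connected (insert z S)"
    using assms(1) by (rule connected_intermediate_closure) (use z closure_subset[of S] in auto)
  then have "connected (insert z S \<union> T)"
    using assms(2) z by (intro connected_Un) auto
  then show ?thesis using z by (simp add: insert_absorb)
qed

lemma subset_outside_connected:
  assumes "connected X" "X \<inter> A = {}" "X \<inter> outside A \<noteq> {}"
  shows "X \<subseteq> outside A"
proof
  fix y assume y: "y \<in> X"
  obtain x where x: "x \<in> X" "x \<in> outside A" using assms by blast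
  have "connected_component (- A) x y"
    unfolding connected_component_def using assms x y by (intro exI[of _ X]) auto
  then show "y \<in> outside A" using x outside_same_component by blast
qed

lemma unbounded_connected_subset_outside:
  assumes "connected X" "X \<inter> A = {}" "\<not> bounded X"
  shows "X \<subseteq> outside A"
proof
  fix x assume "x \<in> X"
  then have "X \<subseteq> connected_component_set (- A) x"
    using assms by (intro connected_component_maximal) auto
  then have "\<not> bounded (connected_component_set (- A) x)"
    using assms(3) bounded_subset by blast
  then show "x \<in> outside A" by (simp add: outside)
qed

section \<open>Theta-shaped sets in the plane\<close>

text \<open>By the dual Janiszewski theorem \<open>E1 \<union> E2\<close> separates the plane,
  because \<open>Q\<close> is disconnected. A component \<open>B\<close> of its complement other
  than the one containing \<open>V\<close> borders both \<open>E1 - Q\<close> and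
  \<open>E2 - Q\<close>. Hence \<open>V\<close> and \<open>B\<close> can be joined through
  \<open>E1 - Q\<close> off \<open>E2 \<union> E3\<close>, and through \<open>E2 - Q\<close> off
  \<open>E1 \<union> E3\<close>; Janiszewski's theorem then joins them off the union of these sets,
  a contradiction.\<close>

lemma no_component_borders_theta:
  fixes E1 E2 E3 Q V :: "complex set"
  assumes E1: "compact E1" "connected E1" "connected (- E1)"
    and E2: "compact E2" "connected E2" "connected (- E2)"
    and E3: "compact E3" "connected E3" "connected (- E3)"
    and int: "E1 \<inter> E2 = Q" "E1 \<inter> E3 = Q" "E2 \<inter> E3 = Q"
    and Q: "\<not> connected Q"
    and con: "connected (E1 - Q)" "connected (E2 - Q)" "connected (E3 - Q)"
    and V: "connected V" "V \<inter> (E1 \<union> E2 \<union> E3) = {}"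
    and touch: "closure V \<inter> (E1 - Q) \<noteq> {}" "closure V \<inter> (E2 - Q) \<noteq> {}" "closure V \<inter> (E3 - Q) \<noteq> {}"
  shows False
proof -
  \<comment> \<open>\<open>V\<close> borders \<open>E3 - Q\<close>, so both lie in one component of
    the complement of \<open>E1 \<union> E2\<close>; this keeps \<open>B\<close> away from
    \<open>E3\<close>.\<close>
  define X where "X = V \<union> (E3 - Q)"
  have X: "connected X" "X \<subseteq> - (E1 \<union> E2)"
  proof -
    show "connected X" unfolding X_def using V con touch by (intro connected_Un_closure_meets) auto
    show "X \<subseteq> - (E1 \<union> E2)" unfolding X_def using V(2) int by blast
  qed
  have nc: "\<not> connected (- (E1 \<union> E2))"
    using Janiszewski_dual[of E1 E2] E1 E2 int Q by blast
  obtain v where v: "v \<in> V" using touch by fastforce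
  have "\<exists>b. b \<in> - (E1 \<union> E2) \<and> \<not> connected_component (- (E1 \<union> E2)) v b"
  proof (rule ccontr)
    assume "\<not> ?thesis"
    then have "- (E1 \<union> E2) = connected_component_set (- (E1 \<union> E2)) v"
      using connected_component_subset by blast
    then show False using nc connected_connected_component by metis
  qed
  then obtain b where b: "b \<in> - (E1 \<union> E2)" "\<not> connected_component (- (E1 \<union> E2)) v b" by blast
  define B where "B = connected_component_set (- (E1 \<union> E2)) b"
  have Bc: "connected B" "b \<in> B" "B \<subseteq> - (E1 \<union> E2)"
    unfolding B_def using b connected_component_subset by fastforce+
  have BX: "B \<inter> X = {}"
  proof (rule ccontr)
    assume "B \<inter> X \<noteq> {}"
    then have "connected (B \<union> X)" using Bc X by (intro connected_Un) auto
    moreover have "B \<union> X \<subseteq> - (E1 \<union> E2)" using Bc X by blast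
    ultimately have "connected_component (- (E1 \<union> E2)) v b"
      unfolding connected_component_def using v Bc(2) X_def by blast
    then show False using b by blast
  qed
  have frB: "frontier B \<subseteq> E1 \<union> E2"
    unfolding B_def using E1(1) E2(1) b(1)
    by (intro frontier_of_components_closed_complement) (auto simp: compact_imp_closed componentsI)
  \<comment> \<open>\<open>- G\<close> is connected, contains \<open>B\<close>, and contains the
    points of \<open>F - Q\<close>, which are not in \<open>B\<close>. So it contains a frontier
    point of \<open>B\<close>, and that point must lie in \<open>F - Q\<close>.\<close>
  have meets: "closure B \<inter> (F - Q) \<noteq> {}"
    if "connected (- G)" "frontier B \<subseteq> F \<union> G" "F \<inter> G = Q" "B \<inter> (F \<union> G) = {}" "F - Q \<noteq> {}" for F G
  proof -
    have "- G \<inter> frontier B \<noteq> {}"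
      using that Bc(2) by (intro connected_Int_frontier) auto
    then show ?thesis using that by (auto simp: frontier_def)
  qed
  have m1: "closure B \<inter> (E1 - Q) \<noteq> {}"
    using frB Bc(3) touch(1) by (intro meets[OF E2(3) _ int(1)]) auto
  have m2: "closure B \<inter> (E2 - Q) \<noteq> {}"
    using frB Bc(3) touch(2) int(1) by (intro meets[OF E1(3)]) auto
  have BE3: "B \<inter> E3 = {}"
    using BX Bc(3) int unfolding X_def by blast
  have join: "connected_component (- G) v b"
    if "connected F" "closure V \<inter> F \<noteq> {}" "closure B \<inter> F \<noteq> {}" "(V \<union> F \<union> B) \<inter> G = {}" for F G
  proof -
    have "connected ((V \<union> F) \<union> (B \<union> F))"
      using that V Bc by (intro connected_Un connected_Un_closure_meets) auto
    then show ?thesis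
      unfolding connected_component_def using v Bc(2) that by (intro exI[of _ "(V \<union> F) \<union> (B \<union> F)"]) auto
  qed
  have "connected_component (- (E2 \<union> E3)) v b"
    using V Bc BE3 int by (intro join[of "E1 - Q"]) (use con m1 touch in auto)
  moreover have "connected_component (- (E1 \<union> E3)) v b"
    using V Bc BE3 int by (intro join[of "E2 - Q"]) (use con m2 touch in auto)
  \<comment> \<open>\<open>E1 \<inter> E2 = Q\<close> is contained in \<open>E3\<close>, so the two
    obstacles intersect in a connected set, as Janiszewski's theorem requires.\<close>
  moreover have "(E2 \<union> E3) \<inter> (E1 \<union> E3) = E3" using int by blast
  ultimately have "connected_component (- ((E2 \<union> E3) \<union> (E1 \<union> E3))) v b"
    using E1(1) E2(1) E3(1,2)
    by (intro Janiszewski[of "E2 \<union> E3" "E1 \<union> E3"]) (simp_all only: compact_Un compact_imp_closed)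
  then have "connected_component (- (E1 \<union> E2)) v b"
    by (rule connected_component_of_subset) auto
  then show False using b by blast
qed

section \<open>Crosscuts and filled continua\<close>

text \<open>\<open>T\<close> is an arc provided by the density of accessible frontier points; an arc
  does not separate the plane. Only its end points lie on the frontier, so
  \<open>T \<inter> D\<close> is the open arc.\<close>

lemma crosscut:
  fixes D :: "complex set"
  assumes "open D" "connected D"
    and ope: "openin (top_of_set (frontier D)) V1" "openin (top_of_set (frontier D)) V2"
    and V: "V1 \<noteq> {}" "V2 \<noteq> {}" "V1 \<inter> V2 = {}"
  obtains T p q where "compact T" "connected T" "connected (- T)"
    "p \<in> V1" "q \<in> V2" "p \<in> T" "q \<in> T" "T \<subseteq> insert p (insert q D)"
    "connected (T \<inter> D)" "T \<inter> D \<noteq> {}"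
proof -
  obtain g where g: "arc g" "pathstart g \<in> V1" "pathfinish g \<in> V2" "g ` {0<..<1} \<subseteq> D"
    using dense_accessible_frontier_point_pairs[OF assms(1,2) ope V(1,2)] V by blast
  have fr: "V1 \<subseteq> frontier D" "V2 \<subseteq> frontier D" using ope openin_imp_subset by blast+
  have D: "frontier D \<inter> D = {}" using \<open>open D\<close> by (auto simp: frontier_def interior_open)
  have im: "path_image g = insert (pathstart g) (insert (pathfinish g) (g ` {0<..<1}))"
  proof -
    have "{0..1::real} = insert 0 (insert 1 {0<..<1})" by auto
    then show ?thesis by (simp add: path_image_def pathstart_def pathfinish_def)
  qed
  have TD: "path_image g \<inter> D = g ` {0<..<1}"
  proof -
    have "pathstart g \<notin> D" "pathfinish g \<notin> D" using g(2,3) fr D by auto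
    then show ?thesis using g(4) unfolding im by (simp add: Int_absorb2)
  qed
  show ?thesis
  proof (rule that[of "path_image g" "pathstart g" "pathfinish g"])
    show "connected (- path_image g)" using g by (simp add: connected_arc_complement)
    have "continuous_on {0<..<1} g"
      using g by (meson arc_imp_path continuous_on_subset greaterThanLessThan_subseteq_atLeastAtMost_iff order_refl path_def)
    then show "connected (path_image g \<inter> D)" unfolding TD by (intro connected_continuous_image) auto
    show "path_image g \<inter> D \<noteq> {}" unfolding TD by auto
    show "compact (path_image g)" "connected (path_image g)"
      using g by (auto simp: arc_imp_path compact_path_image connected_path_image)
    show "path_image g \<subseteq> insert (pathstart g) (insert (pathfinish g) D)"
      unfolding im using g(4) by (intro insert_mono)
  qed (use g in auto)
qed

text \<open>This serves to enlarge a continuum by connected pieces of the frontiers of three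
  domains. Each closure is connected and meets \<open>A\<close>, so they can be attached one at a
  time.\<close>

lemma continuum_Un_closures:
  fixes A :: "complex set" and V :: "nat \<Rightarrow> complex set"
  assumes A: "compact A" "connected A"
    and V: "\<And>j. j < (3::nat) \<Longrightarrow> connected (V j)" "\<And>j. j < 3 \<Longrightarrow> V j \<inter> A \<noteq> {}"
      "\<And>j. j < 3 \<Longrightarrow> bounded (V j)"
  shows "compact (A \<union> (\<Union>j<3. closure (V j)))" "connected (A \<union> (\<Union>j<3. closure (V j)))"
proof -
  show "compact (A \<union> (\<Union>j<3. closure (V j)))"
    using A V by (intro compact_Un compact_UN) auto
  have "connected (A \<union> (\<Union>j\<in>J. closure (V j)))" if "J \<subseteq> {..<3}" "finite J" for J
    using that(2,1)
  proof (induction J)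
    case (insert j J)
    have j: "j < 3" "J \<subseteq> {..<3}" using insert.prems by auto
    have "connected ((A \<union> (\<Union>j\<in>J. closure (V j))) \<union> closure (V j))"
    proof (rule connected_Un)
      show "connected (closure (V j))" by (intro connected_imp_connected_closure V j)
      show "(A \<union> (\<Union>j\<in>J. closure (V j))) \<inter> closure (V j) \<noteq> {}"
        using V(2)[OF j(1)] closure_subset[of "V j"] by blast
    qed (use insert.IH[OF j(2)] in auto)
    then show ?case by (simp add: Un_ac)
  qed (use A in auto)
  then show "connected (A \<union> (\<Union>j<3. closure (V j)))" by blast
qed

text \<open>\<open>- outside A\<close> is \<open>A\<close> with its bounded complementary components
  filled in. The filling has connected complement, as the separation theorems applied to it later
  require.\<close>

lemma continuum_filled:
  fixes A :: "complex set"
  assumes A: "compact A" "connected A"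
  shows "compact (- outside A)" "connected (- outside A)" "connected (outside A)" "A \<subseteq> - outside A"
proof -
  have eq: "- outside A = A \<union> inside A" by (simp add: union_with_inside)
  have "closed (- outside A)"
    using A by (simp add: compact_imp_closed open_outside closed_Compl)
  moreover have "bounded (- outside A)"
    unfolding eq using A by (simp add: bounded_inside compact_imp_bounded)
  ultimately show "compact (- outside A)" by (simp add: compact_eq_bounded_closed)
  show "connected (- outside A)"
    unfolding eq using A by (simp add: connected_with_inside compact_imp_closed)
  show "connected (outside A)"
    using A by (simp add: connected_outside compact_imp_bounded)
  show "A \<subseteq> - outside A" using eq by blast
qed

section \<open>Three continua touching three plane domains\<close>

text \<open>The continua and the domains stand for the two vertex classes of the complete bipartite
  graph on 3 + 3 vertices. \<open>A1\<close> and \<open>A2\<close> are thickened along the frontiers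
  and filled to \<open>H1\<close> and \<open>H2\<close>; a crosscut of each \<open>D j\<close>
  between them gives three continua with common part \<open>Q = H1 \<union> H2\<close>. The
  complementary component containing \<open>A3\<close> borders all three crosscuts, contrary to
  \<open>no_component_borders_theta\<close>. The thickening is there because accessible points are
  only dense in a frontier, so a crosscut need not end in \<open>A1\<close> or \<open>A2\<close>
  itself.\<close>

lemma no_three_continua_three_domains:
  fixes D :: "nat \<Rightarrow> complex set" and A1 A2 A3 :: "complex set"
  assumes D: "\<And>j. j < 3 \<Longrightarrow> open (D j)" "\<And>j. j < 3 \<Longrightarrow> connected (D j)"
      "\<And>j. j < 3 \<Longrightarrow> locally connected (frontier (D j))"
    and unb: "\<not> bounded (D 0)"
    and Ddisj: "\<And>i j. i < 3 \<Longrightarrow> j < 3 \<Longrightarrow> i \<noteq> j \<Longrightarrow> D i \<inter> D j = {}"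
    and A: "compact A1" "connected A1" "compact A2" "connected A2" "compact A3" "connected A3"
    and Adisj: "A1 \<inter> A2 = {}" "A1 \<inter> A3 = {}" "A2 \<inter> A3 = {}"
    and AD: "\<And>j. j < 3 \<Longrightarrow> D j \<inter> (A1 \<union> A2 \<union> A3) = {}"
    and touch: "\<And>j. j < 3 \<Longrightarrow> frontier (D j) \<inter> A1 \<noteq> {}"
      "\<And>j. j < 3 \<Longrightarrow> frontier (D j) \<inter> A2 \<noteq> {}"
      "\<And>j. j < 3 \<Longrightarrow> frontier (D j) \<inter> A3 \<noteq> {}"
  shows False
proof -
  obtain d1 where d1: "d1 > 0" "\<And>x y. x \<in> A1 \<Longrightarrow> y \<in> A2 \<Longrightarrow> d1 \<le> dist x y"
    using separate_compact_closed[of A1 A2] A Adisj compact_imp_closed by metis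
  obtain d2 where d2: "d2 > 0" "\<And>x y. x \<in> A1 \<Longrightarrow> y \<in> A3 \<Longrightarrow> d2 \<le> dist x y"
    using separate_compact_closed[of A1 A3] A Adisj compact_imp_closed by metis
  obtain d3 where d3: "d3 > 0" "\<And>x y. x \<in> A2 \<Longrightarrow> y \<in> A3 \<Longrightarrow> d3 \<le> dist x y"
    using separate_compact_closed[of A2 A3] A Adisj compact_imp_closed by metis
  \<comment> \<open>A third of the least distance: a point within \<open>e\<close> of both
    \<open>A1\<close> and \<open>A2\<close> would put these at distance at most
    \<open>2 * e\<close>. So the thickenings \<open>B1\<close>, \<open>B2\<close> and the set
    \<open>A3\<close> remain pairwise disjoint.\<close>
  define e where "e = Min {d1, d2, d3} / 3"
  have e: "e > 0" "3 * e \<le> d1" "3 * e \<le> d2" "3 * e \<le> d3"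
    using d1 d2 d3 unfolding e_def by auto
  \<comment> \<open>Local connectedness of the frontier gives a connected piece near a touching
    point; its relative openness lets a crosscut end in it.\<close>
  have nbhd: "\<exists>V. \<forall>j<3. openin (top_of_set (frontier (D j))) (V j) \<and> connected (V j) \<and> V j \<inter> A \<noteq> {} \<and>
      (\<exists>z\<in>A. V j \<subseteq> cball z e)"
    if t: "\<And>j. j < 3 \<Longrightarrow> frontier (D j) \<inter> A \<noteq> {}" for A
  proof -
    have "\<exists>V. openin (top_of_set (frontier (D j))) V \<and> connected V \<and> V \<inter> A \<noteq> {} \<and>
        (\<exists>z\<in>A. V \<subseteq> cball z e)" if j: "j < 3" for j
    proof -
      obtain z where z: "z \<in> frontier (D j)" "z \<in> A" using t[OF j] by blast
      have o: "openin (top_of_set (frontier (D j))) (frontier (D j) \<inter> ball z e)" by blast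
      obtain U where U: "openin (top_of_set (frontier (D j))) U" "connected U" "z \<in> U"
          "U \<subseteq> frontier (D j) \<inter> ball z e"
        using D(3)[OF j] o z e(1) unfolding locally_connected by (metis IntI centre_in_ball)
      have "U \<subseteq> cball z e" using U(4) ball_subset_cball by blast
      then show ?thesis using U z by blast
    qed
    then show ?thesis by (intro choice) blast
  qed
  obtain V1 where V1: "\<And>j. j < 3 \<Longrightarrow> openin (top_of_set (frontier (D j))) (V1 j)"
      "\<And>j. j < 3 \<Longrightarrow> connected (V1 j)" "\<And>j. j < 3 \<Longrightarrow> V1 j \<inter> A1 \<noteq> {}"
      "\<And>j. j < 3 \<Longrightarrow> \<exists>z\<in>A1. V1 j \<subseteq> cball z e"
    using nbhd[OF touch(1)] by metis
  obtain V2 where V2: "\<And>j. j < 3 \<Longrightarrow> openin (top_of_set (frontier (D j))) (V2 j)"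
      "\<And>j. j < 3 \<Longrightarrow> connected (V2 j)" "\<And>j. j < 3 \<Longrightarrow> V2 j \<inter> A2 \<noteq> {}"
      "\<And>j. j < 3 \<Longrightarrow> \<exists>z\<in>A2. V2 j \<subseteq> cball z e"
    using nbhd[OF touch(2)] by metis
  have bV: "bounded (V1 j)" "bounded (V2 j)" if "j < 3" for j
    using V1(4) V2(4) that bounded_cball bounded_subset by blast+
  have clV1: "\<exists>z\<in>A1. closure (V1 j) \<subseteq> cball z e" if "j < 3" for j
    using V1(4)[OF that] closure_minimal closed_cball by metis
  have clV2: "\<exists>z\<in>A2. closure (V2 j) \<subseteq> cball z e" if "j < 3" for j
    using V2(4)[OF that] closure_minimal closed_cball by metis
  define B1 where "B1 = A1 \<union> (\<Union>j<3. closure (V1 j))"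
  define B2 where "B2 = A2 \<union> (\<Union>j<3. closure (V2 j))"
  have B: "compact B1" "connected B1" "compact B2" "connected B2"
    unfolding B1_def B2_def using continuum_Un_closures A V1 V2 bV by simp_all
  have AB: "A1 \<subseteq> B1" "A2 \<subseteq> B2" unfolding B1_def B2_def by auto
  have VB: "V1 j \<subseteq> B1" "V2 j \<subseteq> B2" if "j < 3" for j
    unfolding B1_def B2_def using that closure_subset by fastforce+
  have near1: "\<exists>z\<in>A1. dist z x \<le> e" if x: "x \<in> B1" for x
  proof (cases "x \<in> A1")
    case False
    then obtain j where "j < 3" "x \<in> closure (V1 j)" using x unfolding B1_def by blast
    then show ?thesis using clV1[of j] by fastforce
  qed (use e in force)
  have near2: "\<exists>z\<in>A2. dist z x \<le> e" if x: "x \<in> B2" for x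
  proof (cases "x \<in> A2")
    case False
    then obtain j where "j < 3" "x \<in> closure (V2 j)" using x unfolding B2_def by blast
    then show ?thesis using clV2[of j] by fastforce
  qed (use e in force)
  have "x \<notin> B2" if x: "x \<in> B1" for x
  proof
    assume "x \<in> B2"
    obtain z w where "z \<in> A1" "dist z x \<le> e" "w \<in> A2" "dist w x \<le> e"
      using near1[OF x] near2[OF \<open>x \<in> B2\<close>] by blast
    then show False using d1(2)[of z w] e dist_triangle2[of z w x] by linarith
  qed
  then have B12: "B1 \<inter> B2 = {}" by blast
  have "x \<notin> A3" if "x \<in> B1" for x
    using near1[OF that] d2(2)[of _ x] e by fastforce
  then have B13: "B1 \<inter> A3 = {}" by blast
  have "x \<notin> A3" if "x \<in> B2" for x
    using near2[OF that] d3(2)[of _ x] e by fastforce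
  then have B23: "B2 \<inter> A3 = {}" by blast
  have frD: "frontier (D k) \<inter> D j = {}" if "j < 3" "k < 3" for j k
  proof (cases "j = k")
    case True then show ?thesis using D(1)[OF that(1)] by (auto simp: frontier_def interior_open)
  next
    case False
    then have "D k \<inter> D j = {}" using Ddisj that by simp
    then have "closure (D k) \<inter> D j = {}" using D(1)[OF that(1)] open_Int_closure_eq_empty[of "D j" "D k"] by blast
    then show ?thesis by (auto simp: frontier_def)
  qed
  have clV: "closure (V1 k) \<subseteq> frontier (D k)" "closure (V2 k) \<subseteq> frontier (D k)" if "k < 3" for k
    using V1(1)[OF that, THEN openin_imp_subset] V2(1)[OF that, THEN openin_imp_subset]
    by (simp_all add: closure_minimal)
  have BD: "B1 \<inter> D j = {}" "B2 \<inter> D j = {}" if "j < 3" for j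
    using AD[OF that] frD[OF that] clV unfolding B1_def B2_def by blast+
  have clD: "closure (D j) \<inter> A1 \<noteq> {}" "closure (D j) \<inter> A2 \<noteq> {}" "closure (D j) \<inter> A3 \<noteq> {}" if "j < 3" for j
    using touch[OF that] by (auto simp: frontier_def)
  \<comment> \<open>The unbounded domain \<open>D 0\<close> misses \<open>F\<close>, so it lies
    outside \<open>F\<close>. Connectedness carries this over to \<open>G\<close> and
    \<open>A3\<close>, which touch \<open>D 0\<close>, and from \<open>G\<close> to each
    \<open>D j\<close>.\<close>
  have out: "D j \<subseteq> outside F \<and> G \<subseteq> outside F \<and> A3 \<subseteq> outside F"
    if F: "\<And>i. i < 3 \<Longrightarrow> F \<inter> D i = {}" "F \<inter> G = {}" "F \<inter> A3 = {}" "connected G" 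
      "\<And>i. i < 3 \<Longrightarrow> closure (D i) \<inter> G \<noteq> {}" and j: "j < 3" for F G j
  proof -
    have D0: "D 0 \<subseteq> outside F" "D 0 \<noteq> {}"
      using unbounded_connected_subset_outside[of "D 0" F] D(2)[of 0] F(1)[of 0] unb by auto
    have step: "Y \<subseteq> outside F"
      if "X \<subseteq> outside F" "X \<noteq> {}" "connected (X \<union> Y)" "Y \<inter> F = {}" for X Y
    proof -
      have "X \<union> Y \<subseteq> outside F" using that outside_no_overlap[of F]
        by (intro subset_outside_connected) blast+
      then show ?thesis by blast
    qed
    have G: "G \<subseteq> outside F" "G \<noteq> {}"
    proof -
      show "G \<subseteq> outside F"
        using D0 F(2) F(5)[of 0] connected_Un_closure_meets[OF D(2)[of 0] F(4)]
        by (intro step[of "D 0" G]) auto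
      show "G \<noteq> {}" using F(5)[of 0] by auto
    qed
    have "connected (G \<union> D j)"
      using connected_Un_closure_meets[OF D(2)[OF j] F(4)] F(5)[OF j] by (simp add: Un_commute)
    then have "D j \<subseteq> outside F"
      using G F(1)[OF j] by (intro step[of G "D j"]) auto
    moreover have "A3 \<subseteq> outside F"
      using D0 F(3) connected_Un_closure_meets[OF D(2)[of 0] A(6)] clD(3)[of 0]
      by (intro step[of "D 0" A3]) auto
    ultimately show ?thesis using G by blast
  qed
  have clB: "closure (D j) \<inter> B1 \<noteq> {}" "closure (D j) \<inter> B2 \<noteq> {}" if "j < 3" for j
    using clD[OF that] AB by blast+
  have out1: "D j \<subseteq> outside B1" "B2 \<subseteq> outside B1" "A3 \<subseteq> outside B1" if "j < 3" for j
    using out[of B1 B2 j, OF BD(1) B12 B13 B(4) clB(2) that] by simp_all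
  have B21: "B2 \<inter> B1 = {}" using B12 by blast
  have out2: "D j \<subseteq> outside B2" "B1 \<subseteq> outside B2" "A3 \<subseteq> outside B2" if "j < 3" for j
    using out[of B2 B1 j, OF BD(2) B21 B23 B(2) clB(1) that] by simp_all
  define H1 where "H1 = - outside B1"
  define H2 where "H2 = - outside B2"
  note H1 = continuum_filled[OF B(1,2), folded H1_def] 
  note H2 = continuum_filled[OF B(3,4), folded H2_def]
  have HD: "D j \<inter> H1 = {}" "D j \<inter> H2 = {}" if "j < 3" for j
    unfolding H1_def H2_def using out1(1)[OF that] out2(1)[OF that] by blast+
  have HA: "A3 \<inter> H1 = {}" "A3 \<inter> H2 = {}" "B2 \<inter> H1 = {}" "B1 \<inter> H2 = {}"
    unfolding H1_def H2_def using out1(2,3)[of 0] out2(2,3)[of 0] by auto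
  have "B1 \<noteq> {}" "B2 \<noteq> {}" using touch[of 0] AB by auto
  \<comment> \<open>Filling keeps the continua disjoint: the connected set \<open>H1\<close> misses
    \<open>B2\<close> and contains \<open>B1\<close>, which lies outside \<open>B2\<close>.\<close>
  have "H1 \<subseteq> outside B2"
    using H1 HA \<open>B1 \<noteq> {}\<close> out2(2)[of 0] by (intro subset_outside_connected) auto
  then have H12: "H1 \<inter> H2 = {}" unfolding H2_def by blast
  define Q where "Q = H1 \<union> H2"
  have Qn: "\<not> connected Q"
  proof -
    have "closed H1" "closed H2" using H1(1) H2(1) by (simp_all add: compact_imp_closed)
    moreover have "H1 \<noteq> {}" "H2 \<noteq> {}" using H1(4) H2(4) \<open>B1 \<noteq> {}\<close> \<open>B2 \<noteq> {}\<close> by auto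
    ultimately show ?thesis
      unfolding Q_def connected_closed not_not using H12
      by (intro exI[of _ H1] exI[of _ H2] conjI) (auto simp: disjoint_iff)
  qed
  have "\<exists>T. compact (T \<union> Q) \<and> connected (T \<union> Q) \<and> connected (- (T \<union> Q)) \<and>
      T \<subseteq> D j \<union> Q \<and> connected (T \<inter> D j) \<and> T \<inter> D j \<noteq> {}" if j: "j < 3" for j
  proof -
    have "V1 j \<noteq> {}" "V2 j \<noteq> {}" "V1 j \<inter> V2 j = {}"
      using V1(3)[OF j] V2(3)[OF j] VB[OF j] B12 by auto
    then obtain T p q where T: "compact T" "connected T" "connected (- T)"
      "p \<in> V1 j" "q \<in> V2 j" "p \<in> T" "q \<in> T" "T \<subseteq> insert p (insert q (D j))"
      "connected (T \<inter> D j)" "T \<inter> D j \<noteq> {}"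
      using crosscut[OF D(1)[OF j] D(2)[OF j] V1(1)[OF j] V2(1)[OF j]] by metis
    have p: "p \<in> H1" "p \<notin> H2" and q: "q \<in> H2" "q \<notin> H1"
      using T(4,5) VB[OF j] H1(4) H2(4) H12 by blast+
    \<comment> \<open>The crosscut meets \<open>H1\<close> only at \<open>p\<close> and
      \<open>H2\<close> only at \<open>q\<close>. Single points are connected, so adjoining
      \<open>H1\<close> and then \<open>H2\<close> to \<open>T\<close> preserves connectedness of
      the complement.\<close>
    have i1: "T \<inter> H1 = {p}" and i2: "(T \<union> H1) \<inter> H2 = {q}"
      using T(6,7,8) p q HD[OF j] H12 by auto
    have nH: "connected (- H1)" "connected (- H2)" using H1(3) H2(3) by (simp_all add: H1_def H2_def)
    have cH: "compact (T \<union> H1)" "closed H1" "closed H2"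
      using T(1) H1(1) H2(1) by (simp_all add: compact_Un compact_imp_closed)
    have 1: "connected (- (T \<union> H1))"
      by (rule Janiszewski_connected[OF T(1) cH(2) _ T(3) nH(1)]) (simp add: i1)
    have 2: "connected (- ((T \<union> H1) \<union> H2))"
      by (rule Janiszewski_connected[OF cH(1) cH(3) _ 1 nH(2)]) (simp add: i2)
    have 3: "connected ((T \<union> H1) \<union> H2)"
      using T(2) H1(2) H2(2) i1 i2 by (intro connected_Un) simp_all
    have eq: "T \<union> Q = (T \<union> H1) \<union> H2" unfolding Q_def by blast
    show ?thesis
    proof (intro exI conjI)
      show "compact (T \<union> Q)" unfolding eq using cH(1) H2(1) by (rule compact_Un)
      show "connected (T \<union> Q)" "connected (- (T \<union> Q))" unfolding eq by (fact 3, fact 2)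
      show "T \<subseteq> D j \<union> Q" using T(8) p(1) q(1) unfolding Q_def by blast
    qed (fact T)+
  qed
  then have "\<forall>j\<in>{..<3}. \<exists>T. compact (T \<union> Q) \<and> connected (T \<union> Q) \<and> connected (- (T \<union> Q)) \<and>
      T \<subseteq> D j \<union> Q \<and> connected (T \<inter> D j) \<and> T \<inter> D j \<noteq> {}" by simp
  from bchoice[OF this] obtain T where T': "\<forall>j\<in>{..<3}. compact (T j \<union> Q) \<and> connected (T j \<union> Q) \<and>
      connected (- (T j \<union> Q)) \<and> T j \<subseteq> D j \<union> Q \<and> connected (T j \<inter> D j) \<and> T j \<inter> D j \<noteq> {}" ..
  have T: "compact (T j \<union> Q)" "connected (T j \<union> Q)" "connected (- (T j \<union> Q))"
      "T j \<subseteq> D j \<union> Q" "connected (T j \<inter> D j)" "T j \<inter> D j \<noteq> {}" if "j < 3" for j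
    using T' that unfolding Ball_def lessThan_iff by blast+
  have QD: "Q \<inter> D j = {}" if "j < 3" for j
    using HD[OF that] unfolding Q_def by blast
  have TT: "(T i \<union> Q) \<inter> (T j \<union> Q) = Q" if "i < 3" "j < 3" "i \<noteq> j" for i j
    using T(4)[OF that(1)] T(4)[OF that(2)] Ddisj[OF that] by blast
  have TQ: "(T j \<union> Q) - Q = T j \<inter> D j" if "j < 3" for j
    using T(4)[OF that] QD[OF that] by blast
  define E where "E = (T 0 \<union> Q) \<union> (T 1 \<union> Q) \<union> (T 2 \<union> Q)"
  have less3: "j = 0 \<or> j = 1 \<or> j = 2" if "j < 3" for j :: nat using that by linarith
  have closedE: "closed E"
    unfolding E_def using T(1)[of 0] T(1)[of 1] T(1)[of 2] by (simp add: closed_Un compact_imp_closed)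
  have A3fr: "A3 \<inter> Q = {}" unfolding Q_def using HA by blast
  have A3D: "A3 \<inter> D j = {}" if "j < 3" for j using AD[OF that] by blast
  have A3E: "A3 \<inter> E = {}"
    unfolding E_def using A3fr T(4)[of 0] T(4)[of 1] T(4)[of 2] A3D[of 0] A3D[of 1] A3D[of 2] by auto
  have "A3 \<noteq> {}" using touch(3)[of 0] by auto
  then obtain a where a: "a \<in> A3" by blast
  define V where "V = connected_component_set (- E) a"
  have aE: "a \<in> - E" using a A3E by blast
  have V: "connected V" "V \<inter> E = {}" unfolding V_def using connected_component_subset by auto
  have A3V: "A3 \<subseteq> V"
    unfolding V_def using A a A3E by (intro connected_component_maximal) auto
  have oV: "open V" unfolding V_def using closedE by (intro open_connected_component) auto
  have frV: "frontier V \<subseteq> E"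
    unfolding V_def using closedE aE by (intro frontier_of_components_closed_complement) (auto simp: componentsI)
  have ED: "E \<inter> D j = T j \<inter> D j" if j: "j < 3" for j
  proof -
    have nT: "T i \<inter> D j = {}" if "i < 3" "i \<noteq> j" for i
      using T(4)[OF that(1)] Ddisj[OF that(1) j that(2)] QD[OF j] by blast
    then show ?thesis unfolding E_def using QD[OF j] nT[of 0] nT[of 1] nT[of 2] less3[OF j]
      by (elim disjE) (auto simp: disjoint_iff)
  qed
  \<comment> \<open>A point of \<open>A3\<close> on the frontier of \<open>D j\<close> lies in the
    open set \<open>V\<close>, so \<open>V\<close> enters \<open>D j\<close>; it cannot fill
    \<open>D j\<close>, since the crosscut is removed. Thus \<open>V\<close> has a frontier point
    inside \<open>D j\<close>, and the only part of \<open>E\<close> there is the crosscut.\<close>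
  have touchV: "closure V \<inter> ((T j \<union> Q) - Q) \<noteq> {}" if j: "j < 3" for j
  proof -
    obtain z where "z \<in> frontier (D j)" "z \<in> A3" using touch(3)[OF j] by blast
    then have "z \<in> closure (D j)" "z \<in> V" using A3V by (auto simp: frontier_def)
    then have 1: "D j \<inter> V \<noteq> {}" using oV by (metis disjoint_iff open_Int_closure_eq_empty inf_commute)
    have "T j \<inter> D j \<subseteq> D j - V" using V(2) ED[OF j] by blast
    then have 2: "D j - V \<noteq> {}" using T(6)[OF j] by blast
    have "D j \<inter> frontier V \<noteq> {}" using connected_Int_frontier[OF D(2)[OF j] 1 2] .
    then show ?thesis unfolding TQ[OF j] using frV ED[OF j] by (auto simp: frontier_def)
  qed
  show False
    by (rule no_component_borders_theta[of "T 0 \<union> Q" "T 1 \<union> Q" "T 2 \<union> Q" Q V])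
      (use T(1-3) TT Qn T(5) V touchV in \<open>simp_all add: TQ E_def\<close>)
qed

section \<open>Stereographic projection from an arbitrary pole\<close>

lemma stereographic_projection:
  assumes "p \<in> riemann_sphere"
  obtains h :: "real^3 \<Rightarrow> complex" and g where "homeomorphism (riemann_sphere - {p}) UNIV h g"
proof -
  have "(sphere 0 1 - {p} :: (real^3) set) homeomorphic (UNIV :: complex set)"
    using assms by (intro homeomorphic_punctured_sphere_affine) (auto simp: riemann_sphere_def)
  then show ?thesis using that unfolding homeomorphic_def riemann_sphere_def by blast
qed

lemma compact_riemann_sphere: "compact riemann_sphere"
  by (simp add: riemann_sphere_def)

lemma openin_punctured_sphere: "openin (top_of_set riemann_sphere) (riemann_sphere - {p})"
  by (simp add: openin_delete)

lemma openin_stereographic_image: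
  fixes h :: "real^3 \<Rightarrow> complex"
  assumes h: "homeomorphism (riemann_sphere - {p}) UNIV h g" and "open D"
  shows "openin (top_of_set riemann_sphere) (g ` D)"
proof -
  have "openin (top_of_set (riemann_sphere - {p})) (g ` D)"
    by (rule homeomorphism_imp_open_map[OF homeomorphism_symD[OF h]])
      (use \<open>open D\<close> in simp)
  then show ?thesis using openin_punctured_sphere openin_trans by blast
qed

lemma stereographic_facts:
  fixes h :: "real^3 \<Rightarrow> complex"
  assumes h: "homeomorphism (riemann_sphere - {p}) UNIV h g"
  shows "g z \<in> riemann_sphere - {p}" "h (g z) = z"
    "x \<in> riemann_sphere - {p} \<Longrightarrow> g (h x) = x"
    "continuous_on D g" "F \<subseteq> riemann_sphere - {p} \<Longrightarrow> continuous_on F h"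
  using h unfolding homeomorphism_def
  by (auto intro: continuous_on_subset)

text \<open>The pole plays the role of infinity. The inside of the image of \<open>F\<close> pulls
  back to a set that is open in the sphere and becomes closed after adding \<open>F\<close>. A
  connected set that contains the pole and misses \<open>F\<close> therefore cannot enter
  it.\<close>

lemma outside_if_joined_to_pole:
  fixes h :: "real^3 \<Rightarrow> complex"
  assumes h: "homeomorphism (riemann_sphere - {p}) UNIV h g"
    and F: "compact F" "F \<subseteq> riemann_sphere - {p}"
    and U: "connected U" "U \<subseteq> riemann_sphere" "p \<in> U" "U \<inter> F = {}" and b: "b \<in> U" "b \<noteq> p"
  shows "h b \<in> outside (h ` F)"
proof (rule ccontr)
  note hf = stereographic_facts[OF h]
  assume "h b \<notin> outside (h ` F)"
  moreover have "h b \<notin> h ` F"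
    using b U F hf(3) by (metis DiffI IntI empty_iff image_iff singletonD subsetD)
  ultimately have hb: "h b \<in> inside (h ` F)" using inside_Un_outside[of "h ` F"] by blast
  have cF: "compact (h ` F)" using F hf(5) by (intro compact_continuous_image) auto
  have "closed (h ` F \<union> inside (h ` F))"
    using cF by (simp add: union_with_inside compact_imp_closed open_outside closed_Compl)
  moreover have "bounded (h ` F \<union> inside (h ` F))"
    using cF by (simp add: bounded_inside compact_imp_bounded)
  ultimately have "compact (g ` (h ` F \<union> inside (h ` F)))"
    using hf(4) by (intro compact_continuous_image) (auto simp: compact_eq_bounded_closed)
  moreover have "g ` (h ` F \<union> inside (h ` F)) = F \<union> g ` inside (h ` F)"
    using F(2) hf(3) by (force simp: image_Un image_image)
  ultimately have cl: "closed (F \<union> g ` inside (h ` F))" by (simp add: compact_imp_closed)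
  have "openin (top_of_set riemann_sphere) (g ` inside (h ` F))"
    using cF by (intro openin_stereographic_image[OF h] open_inside) (simp add: compact_imp_closed)
  then obtain O1 where O1: "open O1" "g ` inside (h ` F) = riemann_sphere \<inter> O1"
    by (auto simp: openin_open)
  have "b \<in> g ` inside (h ` F)" using hb hf(3)[of b] b U(2) by force
  moreover have "p \<notin> g ` inside (h ` F)" using hf(1) by blast
  moreover have "p \<notin> F" using F by blast
  ultimately have "O1 \<inter> U \<noteq> {}" "- (F \<union> g ` inside (h ` F)) \<inter> U \<noteq> {}" using b U O1(2) by blast+
  moreover have "O1 \<inter> - (F \<union> g ` inside (h ` F)) \<inter> U = {}" "U \<subseteq> O1 \<union> - (F \<union> g ` inside (h ` F))"
    unfolding O1(2) using U by auto
  ultimately show False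
    using connectedD[OF U(1) O1(1) open_Compl[OF cl]] by blast
qed

text \<open>The component of \<open>h b\<close> off the image of \<open>F\<close> is unbounded, so
  its pullback accumulates at the pole: otherwise it would lie in a compact part of the punctured
  sphere, whose image is bounded. Adding the limit point \<open>p\<close> keeps it
  connected.\<close>

lemma joined_to_pole_if_outside:
  fixes h :: "real^3 \<Rightarrow> complex"
  assumes h: "homeomorphism (riemann_sphere - {p}) UNIV h g" and p: "p \<in> riemann_sphere"
    and F: "F \<subseteq> riemann_sphere - {p}"
    and b: "b \<in> riemann_sphere - {p}" "h b \<in> outside (h ` F)"
  obtains C where "connected C" "C \<subseteq> riemann_sphere - F" "b \<in> C" "p \<in> C"
proof -
  note hf = stereographic_facts[OF h]
  define X where "X = connected_component_set (- h ` F) (h b)"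
  have X: "connected X" "\<not> bounded X" "X \<subseteq> - h ` F"
    using b(2) unfolding X_def outside using connected_component_subset by auto
  have hb: "h b \<in> X"
  proof -
    have "h b \<in> - h ` F" using b(2) outside_no_overlap[of "h ` F"] by blast
    then show ?thesis unfolding X_def by (simp add: connected_component_refl)
  qed
  have "p \<in> closure (g ` X)"
  proof (rule ccontr)
    assume p': "p \<notin> closure (g ` X)"
    define Y where "Y = riemann_sphere \<inter> closure (g ` X)"
    have "compact Y" unfolding Y_def using compact_riemann_sphere by (simp add: compact_Int_closed)
    moreover have "Y \<subseteq> riemann_sphere - {p}" unfolding Y_def using p' by blast
    ultimately have "compact (h ` Y)" using hf(5) by (intro compact_continuous_image)
    moreover have "g ` X \<subseteq> Y" unfolding Y_def using hf(1) closure_subset[of "g ` X"] by auto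
    then have "X \<subseteq> h ` Y" using hf(2) by (metis image_eqI image_subset_iff subsetI)
    ultimately show False using X(2) bounded_subset compact_imp_bounded by blast
  qed
  show ?thesis
  proof (rule that[of "insert p (g ` X)"])
    have "connected (g ` X)" using X(1) hf(4) by (intro connected_continuous_image)
    then show "connected (insert p (g ` X))"
      by (rule connected_intermediate_closure)
        (use \<open>p \<in> closure (g ` X)\<close> closure_subset[of "g ` X"] in auto)
    have "g x \<notin> F" if "x \<in> X" for x
      using X(3) that hf(2)[of x] by (metis ComplD image_eqI subsetD)
    then show "insert p (g ` X) \<subseteq> riemann_sphere - F" using hf(1) p F by auto
    show "b \<in> insert p (g ` X)" using hb hf(3)[OF b(1)] by (metis image_eqI insertCI)
  qed simp
qed

section \<open>Separation by disjoint compact sets\<close>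

text \<open>A point outside both sets reaches a far point \<open>y\<close> off \<open>X\<close> and
  a far point \<open>z\<close> off \<open>Y\<close>. Beyond a ball containing \<open>X\<close> the
  points \<open>y\<close> and \<open>z\<close> are joined, so \<open>z\<close> is reached off
  \<open>X\<close> as well as off \<open>Y\<close>; Janiszewski's theorem applies because the empty
  intersection is connected.\<close>

lemma outside_Int_subset_outside_Un:
  fixes X Y :: "complex set"
  assumes "compact X" "compact Y" "X \<inter> Y = {}"
  shows "outside X \<inter> outside Y \<subseteq> outside (X \<union> Y)"
proof
  fix x assume x: "x \<in> outside X \<inter> outside Y"
  obtain R where R: "X \<subseteq> cball 0 R"
    using compact_imp_bounded[OF assms(1)] bounded_subset_ballD ball_subset_cball by (metis order_trans)
  have "\<exists>y. B < norm y \<and> connected_component (- (X \<union> Y)) x y" for B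
  proof -
    obtain y where y: "max R B < norm y" "connected_component (- X) x y"
      using x unfolding outside_connected_component_lt by blast
    obtain z where z: "max R B < norm z" "connected_component (- Y) x z"
      using x unfolding outside_connected_component_lt by blast
    have "connected (- cball 0 R :: complex set)"
      by (intro connected_complement_bounded_convex) auto
    moreover have "- cball 0 R \<subseteq> - X" "y \<in> - cball 0 R" "z \<in> - cball 0 R" using R y z by auto
    ultimately have "connected_component (- X) y z"
      unfolding connected_component_def by blast
    with y(2) have "connected_component (- X) x z" by (rule connected_component_trans)
    then have "connected_component (- (X \<union> Y)) x z"
      using assms z(2) by (intro Janiszewski) (auto simp: compact_imp_closed)
    then show ?thesis using z(1) by auto
  qed
  then show "x \<in> outside (X \<union> Y)" unfolding outside_connected_component_lt by blast
qed

text \<open>A point \<open>p\<close> of \<open>N \<inter> W\<close> is taken as pole. A point of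
  \<open>N \<inter> U\<close> is joined to \<open>p\<close> off \<open>G\<close> by \<open>N\<close>
  and off \<open>F\<close> by \<open>U\<close>, hence off both by one connected set, which
  \<open>W\<close> absorbs. This serves to compare \<open>U\<close> with \<open>W\<close> near a
  single boundary curve \<open>F\<close>.\<close>

lemma Janiszewski_sphere_disjoint:
  assumes W: "W \<inter> (F \<union> G) = {}" "\<And>C. connected C \<Longrightarrow> C \<subseteq> riemann_sphere - (F \<union> G) \<Longrightarrow> C \<inter> W \<noteq> {} \<Longrightarrow> C \<subseteq> W"
    and FG: "compact F" "compact G" "F \<union> G \<subseteq> riemann_sphere" "F \<inter> G = {}"
    and N: "connected N" "N \<subseteq> riemann_sphere - G" "N \<inter> W \<noteq> {}"
    and U: "connected U" "U \<subseteq> riemann_sphere - F" "W \<subseteq> U"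
  shows "N \<inter> U \<subseteq> W"
proof
  fix b assume b: "b \<in> N \<inter> U"
  obtain p where p: "p \<in> N" "p \<in> W" using N by blast
  show "b \<in> W"
  proof (cases "b = p")
    case False
    have pS: "p \<in> riemann_sphere" using N p by blast
    obtain h :: "real^3 \<Rightarrow> complex" and g where h: "homeomorphism (riemann_sphere - {p}) UNIV h g"
      using stereographic_projection[OF pS] .
    note hf = stereographic_facts[OF h]
    have FGp: "F \<subseteq> riemann_sphere - {p}" "G \<subseteq> riemann_sphere - {p}" using FG W p by auto
    have "h b \<in> outside (h ` F)"
      using U p b False by (intro outside_if_joined_to_pole[OF h FG(1) FGp(1), of U]) auto
    moreover have "h b \<in> outside (h ` G)"
      using N p b False by (intro outside_if_joined_to_pole[OF h FG(2) FGp(2), of N]) auto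
    moreover have "compact (h ` F)" "compact (h ` G)"
      using FG FGp hf(5) by (auto intro!: compact_continuous_image)
    moreover have "h ` F \<inter> h ` G = {}"
    proof (rule ccontr)
      assume "h ` F \<inter> h ` G \<noteq> {}"
      then obtain u v where "u \<in> F" "v \<in> G" "h u = h v" by blast
      then have "u = v" using hf(3) FGp by (metis subsetD)
      then show False using FG(4) \<open>u \<in> F\<close> \<open>v \<in> G\<close> by blast
    qed
    ultimately have "h b \<in> outside (h ` (F \<union> G))"
      using outside_Int_subset_outside_Un[of "h ` F" "h ` G"] by (auto simp: image_Un)
    moreover have "b \<in> riemann_sphere - {p}" "F \<union> G \<subseteq> riemann_sphere - {p}"
      using b N False FGp by auto
    ultimately obtain C where "connected C" "C \<subseteq> riemann_sphere - (F \<union> G)" "b \<in> C" "p \<in> C"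
      using joined_to_pole_if_outside[OF h pS] by metis
    then show ?thesis using W(2)[of C] p by blast
  qed (use p in simp)
qed

section \<open>Jordan curves on the sphere\<close>

lemma simple_closed_curve_compact_nonempty:
  assumes "simple_closed_curve J"
  shows "compact J" "connected J" "J \<noteq> {}" "J \<subseteq> riemann_sphere"
  using assms unfolding simple_closed_curve_def
  by (auto simp: compact_path_image connected_path_image simple_path_imp_path)

text \<open>With the pole off \<open>J\<close>, the projection is injective on \<open>J\<close> and
  yields a plane Jordan curve. Local connectedness comes from its homeomorphism with a
  circle.\<close>

lemma stereographic_Jordan:
  fixes h :: "real^3 \<Rightarrow> complex"
  assumes h: "homeomorphism (riemann_sphere - {p}) UNIV h g"
    and J: "simple_closed_curve J" "p \<notin> J"
  shows "locally connected (h ` J)" "inside (h ` J) \<noteq> {}"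
    "open (inside (h ` J))" "connected (inside (h ` J))" "frontier (inside (h ` J)) = h ` J"
    "open (outside (h ` J))" "connected (outside (h ` J))" "frontier (outside (h ` J)) = h ` J"
    "\<not> bounded (outside (h ` J))"
proof -
  obtain c where c: "simple_path c" "pathfinish c = pathstart c" "path_image c = J"
    using J(1) unfolding simple_closed_curve_def by blast
  have Jp: "J \<subseteq> riemann_sphere - {p}" using J simple_closed_curve_compact_nonempty(4) by blast
  have inj: "inj_on h J"
    using Jp stereographic_facts(3)[OF h] by (metis inj_onI subsetD)
  have hc: "simple_path (h \<circ> c)"
    using c inj stereographic_facts(5)[OF h Jp] by (intro simple_path_continuous_image) auto
  have hc2: "pathfinish (h \<circ> c) = pathstart (h \<circ> c)" "path_image (h \<circ> c) = h ` J"
    using c by (simp_all add: pathfinish_compose pathstart_compose path_image_compose)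
  have "h ` J homeomorphic sphere (0::complex) 1"
    using homeomorphic_simple_path_image_circle[OF hc hc2(1), of 1 0] hc2(2) by simp
  then show "locally connected (h ` J)"
    using homeomorphic_locally[of "h ` J" "sphere (0::complex) 1" connected connected]
      homeomorphic_connectedness locally_connected_sphere by blast
  show "inside (h ` J) \<noteq> {}"
    "open (inside (h ` J))" "connected (inside (h ` J))" "frontier (inside (h ` J)) = h ` J"
    "open (outside (h ` J))" "connected (outside (h ` J))" "frontier (outside (h ` J)) = h ` J"
    "\<not> bounded (outside (h ` J))"
    using Jordan_inside_outside[OF hc hc2(1)] unfolding hc2(2) by simp_all
qed

text \<open>With the pole in \<open>W\<close>, the rest of \<open>W\<close> is mapped to the outside
  of a plane Jordan curve; \<open>I\<close> is the pullback of the inside.\<close>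

lemma Jordan_domain_avoiding:
  assumes W: "connected W" "W \<noteq> {}" "W \<subseteq> riemann_sphere" and J: "simple_closed_curve J" "W \<inter> J = {}"
  obtains I where "openin (top_of_set riemann_sphere) I" "connected I" "I \<noteq> {}" "I \<inter> J = {}"
    "I \<inter> W = {}" "closed (I \<union> J)" "J \<subseteq> closure I"
proof -
  obtain p where p: "p \<in> W" using W by blast
  obtain h :: "real^3 \<Rightarrow> complex" and g where h: "homeomorphism (riemann_sphere - {p}) UNIV h g"
    using stereographic_projection p W by blast
  note hf = stereographic_facts[OF h]
  have pJ: "p \<notin> J" using p J by blast
  note jor = stereographic_Jordan[OF h J(1) pJ]
  note cJ = simple_closed_curve_compact_nonempty[OF J(1)]
  have Jp: "J \<subseteq> riemann_sphere - {p}" using pJ cJ by blast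
  have ghJ: "g ` h ` J = J"
    using Jp hf(3) by (force simp: image_image)
  show ?thesis
  proof (rule that[of "g ` inside (h ` J)"])
    show "openin (top_of_set riemann_sphere) (g ` inside (h ` J))"
      by (rule openin_stereographic_image[OF h jor(3)])
    show "connected (g ` inside (h ` J))" using jor(4) hf(4) by (intro connected_continuous_image)
    show "g ` inside (h ` J) \<noteq> {}" using jor(2) by simp
    have "z \<notin> inside (h ` J)" if "g z \<in> J" for z
      using that hf(2)[of z] inside_no_overlap[of "h ` J"] by (metis IntI empty_iff image_eqI)
    then show "g ` inside (h ` J) \<inter> J = {}" by blast
    have "z \<notin> inside (h ` J)" if "g z \<in> W" for z
    proof -
      have "h (g z) \<in> outside (h ` J)"
        using W J p that hf(1)[of z] by (intro outside_if_joined_to_pole[OF h cJ(1) Jp, of W]) auto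
      then show ?thesis using hf(2)[of z] inside_Int_outside[of "h ` J"] by (metis IntI empty_iff)
    qed
    then show "g ` inside (h ` J) \<inter> W = {}" by blast
    have "compact (closure (inside (h ` J)))"
    proof -
      have "bounded (inside (h ` J))"
        using cJ(1) hf(5)[OF Jp] by (intro bounded_inside compact_imp_bounded compact_continuous_image)
      then show ?thesis by simp
    qed
    then have "closed (g ` closure (inside (h ` J)))"
      using hf(4) by (intro compact_imp_closed compact_continuous_image)
    moreover have eq: "closure (inside (h ` J)) = inside (h ` J) \<union> h ` J"
      using jor(5) closure_Un_frontier[of "inside (h ` J)"] by simp
    ultimately show "closed (g ` inside (h ` J) \<union> J)" by (simp add: image_Un ghJ)
    have "g ` closure (inside (h ` J)) \<subseteq> closure (g ` inside (h ` J))"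
      using hf(4) closure_subset[of "g ` inside (h ` J)"] by (intro image_closure_subset) auto
    then show "J \<subseteq> closure (g ` inside (h ` J))"
      unfolding eq by (simp add: image_Un ghJ)
  qed
qed

text \<open>The pole is placed in the complementary domain of the first curve, so that this domain
  becomes the unbounded one.\<close>
lemma no_three_continua_three_curves:
  fixes \<Gamma> :: "nat \<Rightarrow> (real^3) set"
  assumes W: "openin (top_of_set riemann_sphere) W" "connected W"
    and G: "\<And>j. j < 3 \<Longrightarrow> simple_closed_curve (\<Gamma> j)" "\<And>j. j < 3 \<Longrightarrow> \<Gamma> j \<inter> W = {}"
      "\<And>j. j < 3 \<Longrightarrow> \<Gamma> j \<subseteq> closure W"
      "\<And>i j. i < 3 \<Longrightarrow> j < 3 \<Longrightarrow> i \<noteq> j \<Longrightarrow> \<Gamma> i \<inter> \<Gamma> j = {}"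
    and A: "compact A1" "connected A1" "compact A2" "connected A2" "compact A3" "connected A3"
      "A1 \<union> A2 \<union> A3 \<subseteq> closure W"
    and Adisj: "A1 \<inter> A2 = {}" "A1 \<inter> A3 = {}" "A2 \<inter> A3 = {}"
    and touch: "\<And>j. j < 3 \<Longrightarrow> \<Gamma> j \<inter> A1 \<noteq> {}" "\<And>j. j < 3 \<Longrightarrow> \<Gamma> j \<inter> A2 \<noteq> {}" "\<And>j. j < 3 \<Longrightarrow> \<Gamma> j \<inter> A3 \<noteq> {}"
  shows False
proof -
  note cG = simple_closed_curve_compact_nonempty[OF G(1)]
  have WS: "W \<subseteq> riemann_sphere" using W openin_imp_subset by blast
  have "W \<noteq> {}" using cG(3)[of 0] G(3)[of 0] by auto
  then obtain I where I: "openin (top_of_set riemann_sphere) I" "connected I" "I \<noteq> {}" "I \<inter> \<Gamma> 0 = {}"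
    "I \<inter> W = {}" "closed (I \<union> \<Gamma> 0)" "\<Gamma> 0 \<subseteq> closure I"
    using Jordan_domain_avoiding[OF W(2) _ WS G(1)[of 0]] G(2)[of 0] by (metis Int_commute zero_less_numeral)
  obtain O1 where O1: "open O1" "I = riemann_sphere \<inter> O1" using I(1) by (auto simp: openin_open)
  have clS: "closure W \<subseteq> riemann_sphere"
    using WS compact_riemann_sphere by (simp add: closure_minimal compact_imp_closed)
  have "O1 \<inter> W = {}" using I(5) O1(2) WS by blast
  then have "O1 \<inter> closure W = {}" using O1(1) by (simp add: open_Int_closure_eq_empty)
  then have IclW: "I \<inter> closure W = {}" using O1(2) by blast
  \<comment> \<open>\<open>I\<close> misses \<open>closure W\<close>, so with the pole in
    \<open>I\<close> the whole of \<open>closure W\<close> is projected to the plane.\<close>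
  obtain p where p: "p \<in> I" using I by blast
  have pS: "p \<in> riemann_sphere" "p \<notin> closure W" using p O1(2) IclW by auto
  obtain h :: "real^3 \<Rightarrow> complex" and g where h: "homeomorphism (riemann_sphere - {p}) UNIV h g"
    using stereographic_projection pS by blast
  note hf = stereographic_facts[OF h]
  have Wp: "closure W \<subseteq> riemann_sphere - {p}" using clS pS by blast
  have Gp: "\<Gamma> j \<subseteq> riemann_sphere - {p}" if "j < 3" for j using G(3)[OF that] Wp by blast
  have pG: "p \<notin> \<Gamma> j" if "j < 3" for j using Gp[OF that] by blast
  note jor = stereographic_Jordan[OF h G(1) pG]
  have hdisj: "h ` X \<inter> h ` Y = {}" if "X \<inter> Y = {}" "X \<subseteq> closure W" "Y \<subseteq> closure W" for X Y
  proof -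
    have "inj_on h (closure W)" using Wp hf(3) by (metis inj_onI subsetD)
    then have "h ` X \<inter> h ` Y = h ` (X \<inter> Y)" using that by (intro inj_on_image_Int[symmetric])
    then show ?thesis using that by simp
  qed
  \<comment> \<open>These represent the complementary domains of the curves that miss
    \<open>W\<close>: for index 0 the domain contains the pole and so appears as the outside, for
    the others it appears as the inside.\<close>
  define D where "D j = (if j = 0 then outside (h ` \<Gamma> 0) else inside (h ` \<Gamma> j))" for j :: nat
  have D: "open (D j)" "connected (D j)" "frontier (D j) = h ` \<Gamma> j" "D j \<noteq> {}" if "j < 3" for j
  proof -
    show "open (D j)" "connected (D j)" "frontier (D j) = h ` \<Gamma> j"
      using jor[OF that that] unfolding D_def by auto
    then show "D j \<noteq> {}" using cG(3)[OF that] by auto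
  qed
  \<comment> \<open>A connected set cannot join \<open>w\<close> to the pole off
    \<open>\<Gamma> 0\<close>, since \<open>I\<close> contains the pole, is relatively open and
    becomes closed on adding \<open>\<Gamma> 0\<close>.\<close>
  have W0: "h w \<notin> outside (h ` \<Gamma> 0)" if w: "w \<in> W" for w
  proof
    assume "h w \<in> outside (h ` \<Gamma> 0)"
    moreover have "w \<in> riemann_sphere - {p}" using w Wp closure_subset by blast
    ultimately obtain C where C: "connected C" "C \<subseteq> riemann_sphere - \<Gamma> 0" "w \<in> C" "p \<in> C"
      using joined_to_pole_if_outside[OF h pS(1) Gp[of 0]] by auto
    have "w \<notin> I" using I(5) w by blast
    have "w \<notin> \<Gamma> 0" using G(2)[of 0] w by auto
    have "O1 \<inter> C \<noteq> {}" using p C(4) O1(2) by blast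
    moreover have "- (I \<union> \<Gamma> 0) \<inter> C \<noteq> {}" using \<open>w \<notin> I\<close> \<open>w \<notin> \<Gamma> 0\<close> C(3) by blast
    moreover have "O1 \<inter> - (I \<union> \<Gamma> 0) \<inter> C = {}" "C \<subseteq> O1 \<union> - (I \<union> \<Gamma> 0)"
      using O1(2) C(2) by blast+
    ultimately show False using connectedD[OF C(1) O1(1) open_Compl[OF I(6)]] by blast
  qed
  \<comment> \<open>For the other curves, \<open>W \<union> (I \<union> \<Gamma> 0)\<close> connects
    \<open>W\<close> to the pole and misses \<open>\<Gamma> j\<close>, so \<open>W\<close> is mapped
    outside the image of \<open>\<Gamma> j\<close>.\<close>
  have "connected (I \<union> \<Gamma> 0)"
    using I(2) by (rule connected_intermediate_closure) (use I(7) closure_subset[of I] in auto)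
  moreover have "closure W \<inter> (I \<union> \<Gamma> 0) \<noteq> {}" using G(3)[of 0] cG(3)[of 0] by auto
  ultimately have conZ: "connected (W \<union> (I \<union> \<Gamma> 0))" by (rule connected_Un_closure_meets[OF W(2)])
  have Wj: "h w \<notin> inside (h ` \<Gamma> j)" if w: "w \<in> W" and j: "j < 3" "j \<noteq> 0" for w j
  proof -
    have "(W \<union> (I \<union> \<Gamma> 0)) \<inter> \<Gamma> j = {}"
      using G(2)[OF j(1)] G(4)[of 0 j] IclW G(3)[OF j(1)] j by auto
    moreover have "W \<union> (I \<union> \<Gamma> 0) \<subseteq> riemann_sphere" using WS O1(2) cG(4)[of 0] by auto
    moreover have "w \<noteq> p" using w pS closure_subset by blast
    ultimately have "h w \<in> outside (h ` \<Gamma> j)"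
      using p w conZ by (intro outside_if_joined_to_pole[OF h cG(1)[OF j(1)] Gp[OF j(1)], of "W \<union> (I \<union> \<Gamma> 0)"]) auto
    then show ?thesis using inside_Int_outside[of "h ` \<Gamma> j"] by blast
  qed
  have DW: "D j \<inter> h ` closure W = {}" if j: "j < 3" for j
  proof -
    have "h ` W \<subseteq> - D j" using W0 Wj j unfolding D_def by auto
    then have "h ` closure W \<subseteq> - D j"
      using hf(5)[OF Wp] D(1)[OF j] by (intro image_closure_subset) auto
    then show ?thesis by blast
  qed
  have DG: "D i \<inter> h ` \<Gamma> j = {}" if "i < 3" "j < 3" for i j
    using DW[OF that(1)] G(3)[OF that(2)] by blast
  \<comment> \<open>\<open>D j\<close> is connected and misses the frontier of \<open>D i\<close>,
    so an overlap would put \<open>D j\<close> within \<open>D i\<close>. The frontier curve of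
    \<open>D j\<close> would then lie in the union of \<open>D i\<close> and its frontier curve,
    both of which are disjoint from it.\<close>
  have Ddisj: "D i \<inter> D j = {}" if ij: "i < 3" "j < 3" "i \<noteq> j" for i j
  proof (rule ccontr)
    assume ne: "D i \<inter> D j \<noteq> {}"
    have "D j \<inter> frontier (D i) = {}" using D(3)[OF ij(1)] DG[OF ij(2,1)] by simp
    then have "D j \<subseteq> D i"
      using connected_Int_frontier[OF D(2)[OF ij(2)], of "D i"] ne by blast
    then have "closure (D j) \<subseteq> D i \<union> h ` \<Gamma> i"
      using closure_mono closure_Un_frontier[of "D i"] D(3)[OF ij(1)] by metis
    moreover have "h ` \<Gamma> j \<subseteq> closure (D j)" using D(3)[OF ij(2)] by (auto simp: frontier_def)
    moreover have "h ` \<Gamma> i \<inter> h ` \<Gamma> j = {}" using hdisj G(3,4) ij by simp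
    ultimately have "h ` \<Gamma> j = {}" using DG[OF ij(1,2)] by blast
    then show False using cG(3)[OF ij(2)] by simp
  qed
  have sub: "A1 \<subseteq> closure W" "A2 \<subseteq> closure W" "A3 \<subseteq> closure W" using A(7) by auto
  note cont = sub[THEN order_trans, OF Wp, THEN hf(5)]
  have hmeet: "h ` X \<inter> h ` Y \<noteq> {}" if "X \<inter> Y \<noteq> {}" for X Y using that by blast
  show False
  proof (rule no_three_continua_three_domains[of D "h ` A1" "h ` A2" "h ` A3"])
    fix j :: nat assume j: "j < 3"
    show "open (D j)" "connected (D j)" using D j by auto
    show "locally connected (frontier (D j))" using D(3)[OF j] jor(1)[OF j j] by simp
    show "D j \<inter> (h ` A1 \<union> h ` A2 \<union> h ` A3) = {}" using DW[OF j] sub by blast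
    show "frontier (D j) \<inter> h ` A1 \<noteq> {}" "frontier (D j) \<inter> h ` A2 \<noteq> {}" "frontier (D j) \<inter> h ` A3 \<noteq> {}"
      unfolding D(3)[OF j] by (intro hmeet touch j)+
  next
    show "\<not> bounded (D 0)" using jor(9)[of 0] unfolding D_def by simp
    show "compact (h ` A1)" "compact (h ` A2)" "compact (h ` A3)"
      using A cont by (simp_all add: compact_continuous_image)
    show "connected (h ` A1)" "connected (h ` A2)" "connected (h ` A3)"
      using A cont by (simp_all add: connected_continuous_image)
  qed (use Ddisj hdisj Adisj sub in simp_all)
qed


section \<open>Regions of the sphere, annuli and clopen subsets\<close>

lemma openin_sphere_component:
  assumes "closed F" "z \<in> riemann_sphere - F"
  shows "openin (top_of_set riemann_sphere) (connected_component_set (riemann_sphere - F) z)"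
proof -
  have o: "openin (top_of_set riemann_sphere) (riemann_sphere - F)"
    using assms(1) by (metis Diff_eq open_Compl openin_open_Int)
  have "locally connected (riemann_sphere - F)"
    by (rule locally_open_subset[OF _ o]) (simp add: riemann_sphere_def locally_connected_sphere)
  then have "openin (top_of_set (riemann_sphere - F)) (connected_component_set (riemann_sphere - F) z)"
    using assms(2) by (intro openin_components_locally_connected) (auto intro: componentsI)
  then show ?thesis using o openin_trans by blast
qed

lemma frontier_of_sphere:
  assumes "openin (top_of_set riemann_sphere) W"
  shows "(top_of_set riemann_sphere) frontier_of W = closure W - W" "closure W \<subseteq> riemann_sphere"
proof -
  have W: "W \<subseteq> riemann_sphere" using assms openin_imp_subset by blast
  then show cl: "closure W \<subseteq> riemann_sphere"
    using compact_riemann_sphere by (simp add: closure_minimal compact_imp_closed)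
  show "(top_of_set riemann_sphere) frontier_of W = closure W - W"
    using assms W cl unfolding frontier_of_def
    by (simp add: interior_of_openin closure_of_subtopology Int_absorb1 inf_absorb2)
qed

text \<open>Away from \<open>closure W - W\<close> the set \<open>W\<close> is both relatively open
  and relatively closed.\<close>

lemma connected_subset_of_region:
  assumes W: "openin (top_of_set riemann_sphere) W"
    and C: "connected C" "C \<subseteq> riemann_sphere - (closure W - W)" "C \<inter> W \<noteq> {}"
  shows "C \<subseteq> W"
proof (rule ccontr)
  assume n: "\<not> C \<subseteq> W"
  obtain O1 where O1: "open O1" "W = riemann_sphere \<inter> O1" using W by (auto simp: openin_open)
  have CW: "C \<inter> closure W \<subseteq> W" using C(2) by blast
  have "O1 \<inter> C \<subseteq> closure W" using C(2) O1(2) closure_subset[of W] by blast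
  then have "O1 \<inter> - closure W \<inter> C = {}" by blast
  moreover have "C \<subseteq> O1 \<union> - closure W" using CW O1(2) by blast
  moreover have "O1 \<inter> C \<noteq> {}" using C(3) O1(2) by blast
  moreover have "- closure W \<inter> C \<noteq> {}" using n CW by blast
  ultimately show False using connectedD[OF C(1) O1(1) open_Compl[OF closed_closure[of W]]] by blast
qed

text \<open>The curves lie in the closure of \<open>W\<close>, hence in that of \<open>U\<close>.
  Conversely, a limit point of \<open>U\<close> off the curves can be added to \<open>U\<close>
  without losing connectedness, so maximality of the component puts it in \<open>U\<close>.\<close>

lemma annulus_between_component:
  assumes W: "openin (top_of_set riemann_sphere) W" "connected W" "w \<in> W"
    and J: "closed J1" "closed J2" "J1 \<union> J2 \<subseteq> closure W - W"
    and U: "U = connected_component_set (riemann_sphere - (J1 \<union> J2)) w"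
  shows "annulus_between J1 J2 U" "W \<subseteq> U" "openin (top_of_set riemann_sphere) U"
    "closure U - U = J1 \<union> J2"
proof -
  have WS: "W \<subseteq> riemann_sphere - (J1 \<union> J2)" using W(1) J(3) openin_imp_subset by blast
  then have w: "w \<in> riemann_sphere - (J1 \<union> J2)" using W(3) by blast
  show WU: "W \<subseteq> U" unfolding U using W WS by (intro connected_component_maximal)
  show oU: "openin (top_of_set riemann_sphere) U"
    unfolding U using J w by (intro openin_sphere_component) auto
  have Us: "U \<subseteq> riemann_sphere - (J1 \<union> J2)" unfolding U by (rule connected_component_subset)
  show fr: "closure U - U = J1 \<union> J2"
  proof
    show "J1 \<union> J2 \<subseteq> closure U - U" using J(3) closure_mono[OF WU] Us by blast
    show "closure U - U \<subseteq> J1 \<union> J2"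
    proof
      fix z assume z: "z \<in> closure U - U"
      show "z \<in> J1 \<union> J2"
      proof (rule ccontr)
        assume "z \<notin> J1 \<union> J2"
        then have "insert z U \<subseteq> riemann_sphere - (J1 \<union> J2)"
          using z Us frontier_of_sphere(2)[OF oU] by blast
        moreover have "connected U" unfolding U by simp
        then have "connected (insert z U)"
          by (rule connected_intermediate_closure) (use z closure_subset[of U] in auto)
        ultimately have "insert z U \<subseteq> U"
          using WU W(3) unfolding U by (intro connected_component_maximal) auto
        then show False using z by blast
      qed
    qed
  qed
  show "annulus_between J1 J2 U"
    unfolding annulus_between_def using w fr frontier_of_sphere(1)[OF oU] by (auto simp: U componentsI)
qed

text \<open>The component of \<open>X\<close> containing \<open>P\<close> cannot leave the
  relatively clopen set \<open>C\<close>, so it is a connected subset of \<open>M\<close>, where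
  \<open>P\<close> is maximal.\<close>

lemma component_of_clopen_superset:
  assumes P: "P \<in> components M" and "M \<subseteq> X"
    and C: "openin (top_of_set X) C" "closed C" "P \<subseteq> C" "C \<subseteq> M"
  shows "P \<in> components X"
proof -
  have Pc: "connected P" "P \<noteq> {}" "P \<subseteq> M"
    using P in_components_connected in_components_nonempty in_components_subset by blast+
  obtain C' where C': "C' \<in> components X" "P \<subseteq> C'"
    using exists_component_superset[of P X] Pc assms(2) by blast
  have c': "connected C'" "C' \<subseteq> X" using C' in_components_connected in_components_subset by blast+
  obtain Oa where Oa: "open Oa" "C = X \<inter> Oa" using C(1) by (auto simp: openin_open)
  have "C' \<subseteq> C"
  proof (rule ccontr)
    assume "\<not> C' \<subseteq> C"
    then have "- C \<inter> C' \<noteq> {}" by blast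
    moreover have "Oa \<inter> C' \<noteq> {}" using Pc C' C(3) Oa(2) by blast
    moreover have "Oa \<inter> - C \<inter> C' = {}" "C' \<subseteq> Oa \<union> - C" using Oa(2) c' by blast+
    ultimately show False using connectedD[OF c'(1) Oa(1) open_Compl[OF C(2)]] by blast
  qed
  then have "C' \<subseteq> P" using Pc C' C(4) c' by (intro components_maximal[OF P]) blast+
  then show ?thesis using C' by (simp add: subset_antisym)
qed

section \<open>From a region with several boundary curves to an annulus\<close>

lemma schoenflies_rel_if_region:
  fixes \<Gamma> :: "nat \<Rightarrow> (real^3) set"
  assumes K: "compact K" "x \<in> K" "y \<in> K"
    and W: "openin (top_of_set riemann_sphere) W" "connected W" and n: "n \<ge> 2"
    and G: "\<forall>i\<in>{1..n}. simple_closed_curve (\<Gamma> i)"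
      "\<forall>i\<in>{1..n}. \<forall>j\<in>{1..n}. i \<noteq> j \<longrightarrow> \<Gamma> i \<inter> \<Gamma> j = {}"
      "(top_of_set riemann_sphere) frontier_of W = (\<Union>i\<in>{1..n}. \<Gamma> i)"
    and P: "inj P" "\<forall>k::nat. P k \<in> components (closure W \<inter> K) \<and> P k \<inter> \<Gamma> 1 \<noteq> {} \<and> P k \<inter> \<Gamma> 2 \<noteq> {}"
    and L: "hausdorff_limit P L" "x \<in> \<Gamma> 1 \<inter> L" "y \<in> \<Gamma> 2 \<inter> L"
  shows "(x, y) \<in> schoenflies_rel K"
proof -
  note cG = simple_closed_curve_compact_nonempty[OF bspec[OF G(1)]]
  have fr: "closure W - W = (\<Union>i\<in>{1..n}. \<Gamma> i)" using G(3) frontier_of_sphere(1)[OF W(1)] by simp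
  have Gi: "\<Gamma> i \<subseteq> closure W - W" if "i \<in> {1..n}" for i unfolding fr using that by blast
  have i12: "1 \<in> {1..n}" "2 \<in> {1..n}" using n by auto
  have G12: "\<Gamma> 1 \<inter> \<Gamma> 2 = {}" using bspec[OF bspec[OF G(2) i12(1)] i12(2)] by simp
  have "W \<noteq> {}"
  proof
    assume "W = {}"
    then have "\<Gamma> 1 \<subseteq> {}" using Gi[OF i12(1)] by simp
    then show False using cG(3)[OF i12(1)] by simp
  qed
  then obtain w where w: "w \<in> W" by auto
  define M where "M = closure W \<inter> K"
  have cM: "compact M" unfolding M_def using K by (simp add: closed_Int_compact)
  have PM: "P k \<in> components M" for k unfolding M_def using P by blast
  have Pc: "compact (P k)" "connected (P k)" "P k \<subseteq> closure W" for k
    using PM[of k] cM compact_components in_components_connected in_components_subset M_def by blast+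
  have Pd: "P k \<inter> P l = {}" if "k \<noteq> l" for k l
    using components_nonoverlap[OF PM PM, of k l] P(1) that by (simp add: inj_eq)
  \<comment> \<open>Three of the \<open>P k\<close> meeting curve \<open>i\<close>, together with
    the curves of index 1, 2 and \<open>i\<close>, form the configuration excluded by
    \<open>no_three_continua_three_curves\<close>.\<close>
  have fin: "finite {k. P k \<inter> \<Gamma> i \<noteq> {}}" if i: "i \<in> {3..n}" for i
  proof (rule ccontr)
    assume "infinite {k. P k \<inter> \<Gamma> i \<noteq> {}}"
    then obtain B where "finite B" "card B = 3" "B \<subseteq> {k. P k \<inter> \<Gamma> i \<noteq> {}}"
      using infinite_arbitrarily_large by blast
    then obtain a b c where abc: "a \<noteq> b" "a \<noteq> c" "b \<noteq> c"
        "P a \<inter> \<Gamma> i \<noteq> {}" "P b \<inter> \<Gamma> i \<noteq> {}" "P c \<inter> \<Gamma> i \<noteq> {}"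
      unfolding card_3_iff by auto
    \<comment> \<open>Renumbers the curves 1, 2 and \<open>i\<close> as 0, 1 and 2.\<close>
    define s where "s j = (if j = 0 then 1 else if j = 1 then 2 else i)" for j :: nat
    have s: "s j \<in> {1..n}" "s j \<in> {1, 2, i}" for j unfolding s_def using i n by auto
    have sd: "s j \<noteq> s k" if "j < 3" "k < 3" "j \<noteq> k" for j k
      using that i unfolding s_def by auto
    have meet: "\<Gamma> (s j) \<inter> P a \<noteq> {} \<and> \<Gamma> (s j) \<inter> P b \<noteq> {} \<and> \<Gamma> (s j) \<inter> P c \<noteq> {}" for j
    proof -
      have "P k \<inter> \<Gamma> 1 \<noteq> {}" "P k \<inter> \<Gamma> 2 \<noteq> {}" for k using P(2) by blast+
      then show ?thesis using s(2)[of j] abc(4-6) by (auto simp: Int_commute)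
    qed
    show False
    proof (rule no_three_continua_three_curves[of W "\<lambda>j. \<Gamma> (s j)" "P a" "P b" "P c"])
      fix j k :: nat
      show "simple_closed_curve (\<Gamma> (s j))" using G(1) s(1) by blast
      show "\<Gamma> (s j) \<inter> W = {}" "\<Gamma> (s j) \<subseteq> closure W" using Gi[OF s(1)[of j]] by blast+
      show "\<Gamma> (s j) \<inter> \<Gamma> (s k) = {}" if "j < 3" "k < 3" "j \<noteq> k"
        using G(2) s(1) sd[OF that] by blast
    qed (use W Pc Pd abc meet in auto)
  qed
  have "finite (\<Union>i\<in>{3..n}. {k. P k \<inter> \<Gamma> i \<noteq> {}})" using fin by blast
  then obtain m where m': "\<forall>k\<in>(\<Union>i\<in>{3..n}. {k. P k \<inter> \<Gamma> i \<noteq> {}}). k < m"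
    unfolding finite_nat_set_iff_bounded by blast
  \<comment> \<open>All excluded indices lie below \<open>m\<close>, so the shift by
    \<open>m\<close> leaves only components that avoid every curve of index at least 3. For
    \<open>n = 2\<close> there are no such curves.\<close>
  have m: "P (k + m) \<inter> \<Gamma> i = {}" if "i \<in> {3..n}" for k i
  proof (rule ccontr)
    assume "P (k + m) \<inter> \<Gamma> i \<noteq> {}"
    then have "k + m < m" using m' that by blast
    then show False by simp
  qed
  define U where "U = connected_component_set (riemann_sphere - (\<Gamma> 1 \<union> \<Gamma> 2)) w"
  have cl12: "closed (\<Gamma> 1)" "closed (\<Gamma> 2)" using cG(1) i12 compact_imp_closed by blast+
  have G12W: "\<Gamma> 1 \<union> \<Gamma> 2 \<subseteq> closure W - W" using Gi i12 by blast
  note U = annulus_between_component[OF W w cl12 G12W U_def]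
  have Uc: "connected U" "U \<subseteq> riemann_sphere - (\<Gamma> 1 \<union> \<Gamma> 2)"
    unfolding U_def using connected_component_subset by simp_all
  \<comment> \<open>Passing from \<open>W\<close> to \<open>U\<close> adds nothing near the first
    two curves. With \<open>H\<close> the union of all curves other than \<open>\<Gamma> i\<close>
    and \<open>N\<close> the component of \<open>z\<close> off \<open>H\<close>, a point of
    \<open>N \<inter> U\<close> is joined to \<open>W\<close> off \<open>H\<close> by
    \<open>N\<close> and off \<open>\<Gamma> i\<close> by \<open>U\<close>, so it lies in
    \<open>W\<close>.\<close>
  have nbhd: "\<exists>N. open N \<and> z \<in> N \<and> riemann_sphere \<inter> N \<inter> U \<subseteq> W" if i: "i \<in> {1, 2}" and z: "z \<in> \<Gamma> i" for i z
  proof -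
    define H where "H = (\<Union>j\<in>{1..n} - {i}. \<Gamma> j)"
    have in': "i \<in> {1..n}" using i i12 by auto
    have cH: "compact H" unfolding H_def using cG(1) by (intro compact_UN) auto
    have GH: "\<Gamma> i \<union> H = closure W - W" unfolding fr H_def using in' by blast
    have GHd: "\<Gamma> i \<inter> H = {}" unfolding H_def using G(2) in' by blast
    have zS: "z \<in> riemann_sphere - H" using z GHd cG(4)[OF in'] by blast
    define N where "N = connected_component_set (riemann_sphere - H) z"
    have N: "openin (top_of_set riemann_sphere) N" "connected N" "N \<subseteq> riemann_sphere - H" "z \<in> N"
      unfolding N_def using openin_sphere_component[OF compact_imp_closed[OF cH] zS] zS
        connected_component_subset by (auto simp: connected_component_refl)
    obtain N' where N': "open N'" "N = riemann_sphere \<inter> N'" using N(1) by (auto simp: openin_open)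
    have "z \<in> closure W" using Gi[OF in'] z by blast
    then have "N' \<inter> W \<noteq> {}" using N'(1) N'(2) N(4) open_Int_closure_eq_empty[of N' W] by blast
    then have NW: "N \<inter> W \<noteq> {}" using N'(2) openin_imp_subset[OF W(1)] by blast
    have "N \<inter> U \<subseteq> W"
    proof (rule Janiszewski_sphere_disjoint[of W "\<Gamma> i" H N U])
      show "C \<subseteq> W" if "connected C" "C \<subseteq> riemann_sphere - (\<Gamma> i \<union> H)" "C \<inter> W \<noteq> {}" for C
        using connected_subset_of_region[OF W(1) that(1)] that GH by simp
      show "W \<inter> (\<Gamma> i \<union> H) = {}" unfolding GH by blast
      show "\<Gamma> i \<union> H \<subseteq> riemann_sphere" unfolding GH using frontier_of_sphere(2)[OF W(1)] by blast
      show "U \<subseteq> riemann_sphere - \<Gamma> i" using Uc(2) i by blast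
    qed (use cG(1)[OF in'] cH GHd N NW Uc U in auto)
    then show ?thesis using N' N(4) by blast
  qed
  have clWU: "closure W \<subseteq> closure U" using U(2) by (rule closure_mono)
  have comp: "P (k + m) \<in> components (closure U \<inter> K)" for k
  proof -
    define H where "H = (\<Union>j\<in>{3..n}. \<Gamma> j)"
    have cH: "closed H" unfolding H_def using cG(1) by (intro closed_UN) (auto simp: compact_imp_closed)
    \<comment> \<open>By the Sura-Bura theorem a compact component has arbitrarily small clopen
      neighbourhoods; one is chosen that avoids the curves of index at least 3.\<close>
    have "P (k + m) \<subseteq> - H" unfolding H_def using m by blast
    then obtain C where C: "openin (top_of_set M) C" "compact C" "P (k + m) \<subseteq> C" "C \<subseteq> - H"
      using Sura_Bura_clopen_subset[OF closed_imp_locally_compact[OF compact_imp_closed[OF cM]] PM Pc(1) open_Compl[OF cH]]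
      by blast
    obtain O' where O': "open O'" "C = M \<inter> O'" using C(1) by (auto simp: openin_open)
    obtain O1 where O1: "open O1" "W = riemann_sphere \<inter> O1" using W(1) by (auto simp: openin_open)
    have clU: "closure U \<subseteq> riemann_sphere" using frontier_of_sphere(2)[OF U(3)] .
    \<comment> \<open>Openness carries over from \<open>M\<close> to the larger trace: a point of
      \<open>C\<close> lies in \<open>W\<close> or on one of the first two curves. Near it
      \<open>closure U\<close> adds nothing to \<open>closure W\<close>, since \<open>U\<close>
      stays within \<open>W\<close> there and the rest of \<open>closure U\<close> is
      \<open>\<Gamma> 1 \<union> \<Gamma> 2\<close>.\<close>
    have op: "openin (top_of_set (closure U \<inter> K)) C"
    proof (subst openin_subopen, intro ballI)
      fix z assume z: "z \<in> C"
      have "\<exists>N. open N \<and> z \<in> N \<and> riemann_sphere \<inter> N \<inter> U \<subseteq> W"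
      proof (cases "z \<in> W")
        case False
        then have "z \<in> closure W - W" using z O'(2) unfolding M_def by blast
        then obtain i where i: "i \<in> {1..n}" "z \<in> \<Gamma> i" unfolding fr by blast
        then have "i \<notin> {3..n}" using z C(4) unfolding H_def by blast
        then have "i \<in> {1, 2}" using i by auto
        then show ?thesis using nbhd i by blast
      qed (use O1 in blast)
      then obtain N where N: "open N" "z \<in> N" "riemann_sphere \<inter> N \<inter> U \<subseteq> W" by blast
      have "z \<in> closure U \<inter> K \<inter> (O' \<inter> N)" using z O'(2) N(2) clWU unfolding M_def by blast
      moreover have "closure U \<inter> K \<inter> (O' \<inter> N) \<subseteq> C"
      proof
        fix u assume u: "u \<in> closure U \<inter> K \<inter> (O' \<inter> N)"
        have "u \<in> closure W"
        proof (cases "u \<in> U")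
          case True then show ?thesis using u N(3) clU closure_subset[of W] by blast
        next
          case False then show ?thesis using u U(4) G12W by blast
        qed
        then show "u \<in> C" using u O'(2) unfolding M_def by blast
      qed
      ultimately show "\<exists>T. openin (top_of_set (closure U \<inter> K)) T \<and> z \<in> T \<and> T \<subseteq> C"
        using O'(1) N(1) by (meson open_Int openin_open_Int)
    qed
    show ?thesis
      by (rule component_of_clopen_superset[OF PM _ op])
        (use C clWU O'(2) compact_imp_closed in \<open>auto simp: M_def\<close>)
  qed
  have "inj (\<lambda>k. P (k + m))" by (rule injI) (use P(1) in \<open>simp add: inj_eq\<close>)
  moreover have "hausdorff_limit (\<lambda>k. P (k + m)) L"
    using L(1) unfolding hausdorff_limit_def by (auto intro: LIMSEQ_ignore_initial_segment)
  moreover have "x \<noteq> y" using L G12 by blast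
  moreover have "\<forall>k. P (k + m) \<in> components (closure U \<inter> K) \<and> P (k + m) \<inter> \<Gamma> 1 \<noteq> {} \<and> P (k + m) \<inter> \<Gamma> 2 \<noteq> {}"
    using comp P(2) by blast
  moreover have "simple_closed_curve (\<Gamma> 1)" "simple_closed_curve (\<Gamma> 2)" using G(1) i12 by blast+
  ultimately show ?thesis
    unfolding schoenflies_rel_def mem_Collect_eq case_prod_conv
    using K(2,3) L(2,3) G12 U(1)
    by (intro conjI, simp_all only:)
      (rule exI[of _ "\<Gamma> 1"], rule exI[of _ "\<Gamma> 2"], rule exI[of _ U], rule exI[of _ "\<lambda>k. P (k + m)"],
        rule exI[of _ L], simp)
qed

theorem theorem2:
  fixes K :: "(real^3) set" and x y :: "real^3"
  assumes "compact K" and "K \<subseteq> riemann_sphere"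
    and "x \<in> K" and "y \<in> K"
  shows "(x, y) \<in> schoenflies_rel K \<longleftrightarrow>
    (\<exists>W n \<Gamma> P L.
       openin (top_of_set riemann_sphere) W \<and> connected W \<and>
       n \<ge> 2 \<and>
       (\<forall>i\<in>{1..n}. simple_closed_curve (\<Gamma> i)) \<and>
       (\<forall>i\<in>{1..n}. \<forall>j\<in>{1..n}. i \<noteq> j \<longrightarrow> \<Gamma> i \<inter> \<Gamma> j = {}) \<and>
       (top_of_set riemann_sphere) frontier_of W = (\<Union>i\<in>{1..(n::nat)}. \<Gamma> i) \<and>
       inj P \<and>
       (\<forall>k. P k \<in> components (closure W \<inter> K) \<and>
            P k \<inter> \<Gamma> 1 \<noteq> {} \<and> P k \<inter> \<Gamma> 2 \<noteq> {}) \<and>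
       hausdorff_limit P L \<and>
       x \<in> \<Gamma> 1 \<inter> L \<and> y \<in> \<Gamma> 2 \<inter> L)"
    (is "?lhs \<longleftrightarrow> ?rhs")
proof
  assume ?lhs
  then obtain J1 J2 U P L where J: "simple_closed_curve J1" "simple_closed_curve J2"
      "J1 \<inter> J2 = {}" "x \<in> J1" "y \<in> J2" "annulus_between J1 J2 U" "inj P"
      "\<forall>n. P n \<in> components (closure U \<inter> K) \<and> P n \<inter> J1 \<noteq> {} \<and> P n \<inter> J2 \<noteq> {}"
      "hausdorff_limit P L" "x \<in> L" "y \<in> L"
    unfolding schoenflies_rel_def by blast
  have U: "U \<in> components (riemann_sphere - (J1 \<union> J2))"
      "(top_of_set riemann_sphere) frontier_of U = J1 \<union> J2"
    using J(6) unfolding annulus_between_def by auto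
  have "closed (J1 \<union> J2)" using J(1,2) simple_closed_curve_compact_nonempty(1) compact_imp_closed by blast
  then have "openin (top_of_set riemann_sphere) U"
    using U(1) openin_sphere_component unfolding components_def by blast
  moreover have "connected U" using U(1) in_components_connected by blast
  \<comment> \<open>The annulus itself is a region with \<open>n = 2\<close>; of the indices sent to
    \<open>J2\<close> only 2 occurs.\<close>
  moreover define \<Gamma> where "\<Gamma> i = (if i = 1 then J1 else J2)" for i :: nat
  moreover have two: "{1..2::nat} = {1, 2}" by auto
  ultimately show ?rhs
    using J U(2)
    by - (rule exI[of _ U], rule exI[of _ "2::nat"], rule exI[of _ \<Gamma>], rule exI[of _ P],
        rule exI[of _ L], simp add: two Int_commute Un_commute)
next
  assume ?rhs
  then show ?lhs using schoenflies_rel_if_region assms(1,3,4) by (elim exE conjE) blast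
qed

end
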